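(* For any $\kappa\in(0,1]$ and any $\epsilon>0$, there exist polymatroid functions with curvature $\kappa$ such that no algorithm using only polynomially many value-oracle queries achieves, for Problem 1 (SCSC) or for Problem 2 (SCSK), a bicriterion factor better than $$\frac{\sigma}{\rho}=\frac{n^{1/2-\epsilon}}{1+(n^{1/2-\epsilon}-1)(1-\kappa)}.$$
   Context: Let $V=\{1,\dots,n\}$. A polymatroid function is a monotone non-decreasing submodular set function $h:2^V\to\mathbb R$ with $h(\emptyset)=0$. Its curvature is $\kappa_h=1-\min_j h(j\mid V\setminus\{j\})/h(\{j\})$, where $h(j\mid S)=h(S\cup\{j\})-h(S)$. Functions are accessed via a value oracle returning $h(X)$ for a queried $X$. Problem 1 (SCSC): given polymatroid $f,g$ and $c$, solve $\min\{f(X):g(X)\ge c\}$. An algorithm achieves bicriterion factor $[\sigma,\rho]$ ($\sigma\ge1\ge\rho$) if it returns $X$ with $f(X)\le\sigma f(X^* )$ and $g(X)\ge\rho c$, where $X^*$ is optimal. Problem 2 (SCSK): solve $\max\{g(X):f(X)\le b\}$. Bicriterion factor $[\rho,\sigma]$ means the output satisfies $g(X)\ge\rho g(X^* )$ and $f(X)\le\sigma b$. A factor is "better than" $\gamma$ if $\sigma/\rho<\gamma$. *)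

theory Defs
  imports "HOL-Probability.Probability" "HOL-Computational_Algebra.Polynomial"
begin

type_synonym set_fun = "nat set \<Rightarrow> real"

definition polymatroid :: "nat set \<Rightarrow> set_fun \<Rightarrow> bool" where
  "polymatroid V h \<longleftrightarrow>
     h {} = 0 \<and> mono_on (Pow V) h \<and>
     (\<forall>X\<subseteq>V. \<forall>Y\<subseteq>V. h (X \<union> Y) + h (X \<inter> Y) \<le> h X + h Y)"

definition marginal :: "set_fun \<Rightarrow> nat \<Rightarrow> nat set \<Rightarrow> real" where
  "marginal h j S = h (S \<union> {j}) - h S"

definition curvature :: "nat set \<Rightarrow> set_fun \<Rightarrow> real" where
  "curvature V h = 1 - Min ((\<lambda>j. marginal h j (V - {j}) / h {j}) ` V)"

text \<open>The quotients in the curvature are meaningful only if all singleton values are positive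
  (in HOL, division by zero would silently give 0), so this is required explicitly.\<close>

definition polymatroid_with_curvature :: "nat set \<Rightarrow> real \<Rightarrow> set_fun \<Rightarrow> bool" where
  "polymatroid_with_curvature V \<kappa> h \<longleftrightarrow>
     polymatroid V h \<and> (\<forall>j\<in>V. 0 < h {j}) \<and> curvature V h = \<kappa>"

text \<open>A deterministic adaptive value-oracle computation, with unlimited computation between
  queries: each query names one of the two oracles and a set, and the continuation depends
  on the real number returned.\<close>

datatype oracle_comp =
    Return "nat set"
  | Query_f "nat set" "real \<Rightarrow> oracle_comp"
  | Query_g "nat set" "real \<Rightarrow> oracle_comp"

primrec returned :: "set_fun \<Rightarrow> set_fun \<Rightarrow> oracle_comp \<Rightarrow> nat set" where
  "returned f g (Return X) = X"
| "returned f g (Query_f X k) = returned f g (k (f X))"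
| "returned f g (Query_g X k) = returned f g (k (g X))"

primrec queries :: "set_fun \<Rightarrow> set_fun \<Rightarrow> oracle_comp \<Rightarrow> nat set list" where
  "queries f g (Return X) = []"
| "queries f g (Query_f X k) = X # queries f g (k (f X))"
| "queries f g (Query_g X k) = X # queries f g (k (g X))"

text \<open>A (possibly randomized) algorithm receives the size of the ground set \<open>{1..n}\<close> and the
  threshold (\<open>c\<close> or \<open>b\<close>) in the clear, and the functions \<open>f\<close>, \<open>g\<close> only through their oracles.
  Deterministic algorithms are the case of point distributions.\<close>

type_synonym algorithm = "nat \<Rightarrow> real \<Rightarrow> oracle_comp pmf"

text \<open>A family of inputs: for each \<open>n\<close> a set of pairs \<open>(f, g)\<close> of functions on subsets of \<open>{1..n}\<close>.\<close>

type_synonym family = "nat \<Rightarrow> (set_fun \<times> set_fun) set"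

definition polynomially_many_queries :: "family \<Rightarrow> algorithm \<Rightarrow> bool" where
  "polynomially_many_queries F A \<longleftrightarrow>
     (\<exists>p :: nat poly. \<forall>n. \<forall>(f, g) \<in> F n. \<forall>t. \<forall>T \<in> set_pmf (A n t).
        set (queries f g T) \<subseteq> Pow {1..n} \<and> length (queries f g T) \<le> poly p n)"

definition SCSC_optimal :: "nat set \<Rightarrow> set_fun \<Rightarrow> set_fun \<Rightarrow> real \<Rightarrow> nat set \<Rightarrow> bool" where
  "SCSC_optimal V f g c X \<longleftrightarrow> is_arg_min f (\<lambda>X. X \<subseteq> V \<and> g X \<ge> c) X"

definition SCSK_optimal :: "nat set \<Rightarrow> set_fun \<Rightarrow> set_fun \<Rightarrow> real \<Rightarrow> nat set \<Rightarrow> bool" where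
  "SCSK_optimal V f g b X \<longleftrightarrow> is_arg_max g (\<lambda>X. X \<subseteq> V \<and> f X \<le> b) X"

text \<open>The algorithm achieves the factor at size \<open>n\<close> if on every feasible input from the family
  its output meets both criteria with probability at least \<open>\<delta>\<close> over its internal randomness
  (for a deterministic algorithm and any \<open>0 < \<delta> \<le> 1\<close> this means that its output meets them).\<close>

definition SCSC_achieves ::
  "family \<Rightarrow> real \<Rightarrow> algorithm \<Rightarrow> nat \<Rightarrow> real \<Rightarrow> real \<Rightarrow> bool" where
  "SCSC_achieves F \<delta> A n \<sigma> \<rho> \<longleftrightarrow>
     (\<forall>(f, g) \<in> F n. \<forall>c X\<^sub>o. SCSC_optimal {1..n} f g c X\<^sub>o \<longrightarrow>
        measure_pmf.prob (map_pmf (returned f g) (A n c))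
          {X. X \<subseteq> {1..n} \<and> f X \<le> \<sigma> * f X\<^sub>o \<and> g X \<ge> \<rho> * c} \<ge> \<delta>)"

definition SCSK_achieves ::
  "family \<Rightarrow> real \<Rightarrow> algorithm \<Rightarrow> nat \<Rightarrow> real \<Rightarrow> real \<Rightarrow> bool" where
  "SCSK_achieves F \<delta> A n \<rho> \<sigma> \<longleftrightarrow>
     (\<forall>(f, g) \<in> F n. \<forall>b X\<^sub>o. SCSK_optimal {1..n} f g b X\<^sub>o \<longrightarrow>
        measure_pmf.prob (map_pmf (returned f g) (A n b))
          {X. X \<subseteq> {1..n} \<and> g X \<ge> \<rho> * g X\<^sub>o \<and> f X \<le> \<sigma> * b} \<ge> \<delta>)"

definition hardness_factor :: "real \<Rightarrow> real \<Rightarrow> nat \<Rightarrow> real" where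
  "hardness_factor \<kappa> \<epsilon> n =
     real n powr (1/2 - \<epsilon>) / (1 + (real n powr (1/2 - \<epsilon>) - 1) * (1 - \<kappa>))"

end

theory Submission
  imports Defs "HOL-Real_Asymp.Real_Asymp"
begin

text \<open>Hide a random set \<open>R\<close> of size \<open>a \<approx> n\<^sup>1\<^sup>/\<^sup>2\<^sup>+\<^sup>e\<close> in the ground set, and let \<open>f\<^sub>R\<close> mix the modular
  function \<open>|X|\<close> with weight \<open>1 - \<kappa>\<close> and \<open>min (|X - R| + min |X \<inter> R| \<beta>) a\<close> with weight \<open>\<kappa>\<close>, where
  \<open>\<beta> = 8 n\<^sup>2\<^sup>e\<close>. Elements of \<open>R\<close> become cheap once more than \<open>\<beta>\<close> of them are taken, which no set
  chosen independently of \<open>R\<close> does except with probability \<open>2\<^sup>-\<^sup>\<beta>\<close>. So polynomially many queries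
  cannot tell \<open>f\<^sub>R\<close> from \<open>f\<^sub>\<emptyset>\<close>, for which a set of size \<open>\<rho> a\<close> costs at least \<open>\<rho> a\<close>, whereas
  \<open>R\<close> costs only \<open>\<kappa> \<beta> + (1 - \<kappa>) a\<close>. The covering function \<open>g\<close> is the cardinality, truncated at
  \<open>n - 1\<close> with weight \<open>\<kappa>\<close> merely to give it curvature \<open>\<kappa>\<close>.\<close>

section \<open>Polymatroids\<close>

lemma polymatroid_card_Int:
  assumes "finite V"
  shows "polymatroid V (\<lambda>X. real (card (X \<inter> S)))"
  unfolding polymatroid_def
proof (intro conjI allI impI)
  show "mono_on (Pow V) (\<lambda>X. real (card (X \<inter> S)))"
    using assms by (auto intro!: mono_onI card_mono simp: finite_subset)
next
  fix X Y assume "X \<subseteq> V" "Y \<subseteq> V"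
  then have "finite (X \<inter> S)" "finite (Y \<inter> S)"
    using assms by (auto intro: finite_subset)
  then have "card (X \<inter> S) + card (Y \<inter> S)
      = card ((X \<inter> S) \<union> (Y \<inter> S)) + card ((X \<inter> S) \<inter> (Y \<inter> S))"
    by (rule card_Un_Int)
  moreover have "(X \<inter> S) \<union> (Y \<inter> S) = (X \<union> Y) \<inter> S" "(X \<inter> S) \<inter> (Y \<inter> S) = (X \<inter> Y) \<inter> S"
    by auto
  ultimately show "real (card ((X \<union> Y) \<inter> S)) + real (card ((X \<inter> Y) \<inter> S))
      \<le> real (card (X \<inter> S)) + real (card (Y \<inter> S))"
    by simp
qed simp

lemma polymatroid_card: "finite V \<Longrightarrow> polymatroid V (\<lambda>X. real (card X))"
  using polymatroid_card_Int[of V UNIV] by simp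

lemma polymatroid_card_Diff: "finite V \<Longrightarrow> polymatroid V (\<lambda>X. real (card (X - S)))"
  using polymatroid_card_Int[of V "- S"] by (simp add: Diff_eq)

lemma polymatroid_add:
  assumes "polymatroid V h" "polymatroid V h'"
  shows "polymatroid V (\<lambda>X. h X + h' X)"
  unfolding polymatroid_def
proof (intro conjI allI impI)
  show "mono_on (Pow V) (\<lambda>X. h X + h' X)"
    using assms by (auto simp: polymatroid_def monotone_on_def intro!: add_mono)
next
  fix X Y assume "X \<subseteq> V" "Y \<subseteq> V"
  then have "h (X \<union> Y) + h (X \<inter> Y) \<le> h X + h Y" "h' (X \<union> Y) + h' (X \<inter> Y) \<le> h' X + h' Y"
    using assms unfolding polymatroid_def by blast+
  then show "h (X \<union> Y) + h' (X \<union> Y) + (h (X \<inter> Y) + h' (X \<inter> Y)) \<le> h X + h' X + (h Y + h' Y)"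
    by linarith
qed (use assms in \<open>auto simp: polymatroid_def\<close>)

lemma polymatroid_scale:
  assumes "polymatroid V h" "0 \<le> r"
  shows "polymatroid V (\<lambda>X. r * h X)"
  unfolding polymatroid_def
proof (intro conjI allI impI)
  show "mono_on (Pow V) (\<lambda>X. r * h X)"
    using assms by (auto simp: polymatroid_def monotone_on_def intro!: mult_left_mono)
next
  fix X Y assume "X \<subseteq> V" "Y \<subseteq> V"
  then have "h (X \<union> Y) + h (X \<inter> Y) \<le> h X + h Y"
    using assms unfolding polymatroid_def by blast
  from mult_left_mono[OF this assms(2)]
  show "r * h (X \<union> Y) + r * h (X \<inter> Y) \<le> r * h X + r * h Y"
    by (simp add: distrib_left)
qed (use assms in \<open>auto simp: polymatroid_def\<close>)

text \<open>Truncation is non-decreasing and concave, and monotonicity places \<open>h X\<close> and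
  \<open>h Y\<close> between \<open>h (X \<inter> Y)\<close> and \<open>h (X \<union> Y)\<close>, so
  submodularity survives.\<close>

lemma polymatroid_truncate:
  assumes "polymatroid V h" "0 \<le> r"
  shows "polymatroid V (\<lambda>X. min (h X) r)"
  unfolding polymatroid_def
proof (intro conjI allI impI)
  show "mono_on (Pow V) (\<lambda>X. min (h X) r)"
    using assms by (auto simp: polymatroid_def monotone_on_def min.coboundedI1)
next
  fix X Y assume XY: "X \<subseteq> V" "Y \<subseteq> V"
  have m: "mono_on (Pow V) h" and "h (X \<union> Y) + h (X \<inter> Y) \<le> h X + h Y"
    using assms XY unfolding polymatroid_def by blast+
  moreover have "h X \<le> h (X \<union> Y)" "h Y \<le> h (X \<union> Y)" "h (X \<inter> Y) \<le> h X" "h (X \<inter> Y) \<le> h Y"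
    using XY by (auto intro!: mono_onD[OF m])
  ultimately show "min (h (X \<union> Y)) r + min (h (X \<inter> Y)) r \<le> min (h X) r + min (h Y) r"
    by (auto simp: min_def)
qed (use assms in \<open>auto simp: polymatroid_def\<close>)

lemma curvature_eqI:
  assumes "finite V" "V \<noteq> {}" "\<And>j. j \<in> V \<Longrightarrow> marginal h j (V - {j}) / h {j} = 1 - \<kappa>"
  shows "curvature V h = \<kappa>"
proof -
  have "(\<lambda>j. marginal h j (V - {j}) / h {j}) ` V = {1 - \<kappa>}"
    using assms by force
  then show ?thesis
    by (simp add: curvature_def)
qed

section \<open>The hard instances\<close>

definition hidden_cost :: "real \<Rightarrow> nat \<Rightarrow> real \<Rightarrow> nat set \<Rightarrow> set_fun" where
  "hidden_cost \<kappa> a \<beta> R X =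
     \<kappa> * min (real (card (X - R)) + min (real (card (X \<inter> R))) \<beta>) (real a)
     + (1 - \<kappa>) * real (card X)"

text \<open>Among subsets of the ground set the truncation acts on the full set only.\<close>

definition near_card :: "real \<Rightarrow> nat \<Rightarrow> set_fun" where
  "near_card \<kappa> n X = \<kappa> * min (real (card X)) (real (n - 1)) + (1 - \<kappa>) * real (card X)"

lemma polymatroid_with_curvature_hidden_cost:
  assumes "0 < \<kappa>" "\<kappa> \<le> 1" "1 \<le> a" "2 * a + 1 \<le> n" "1 \<le> \<beta>" "R \<subseteq> {1..n}" "card R \<le> a"
  shows "polymatroid_with_curvature {1..n} \<kappa> (hidden_cost \<kappa> a \<beta> R)"
  unfolding polymatroid_with_curvature_def
proof (intro conjI ballI)
  show "polymatroid {1..n} (hidden_cost \<kappa> a \<beta> R)"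
    unfolding hidden_cost_def using assms
    by (intro polymatroid_add polymatroid_scale polymatroid_truncate polymatroid_card_Int
        polymatroid_card_Diff polymatroid_card) auto
  \<comment> \<open>Since \<open>1 \<le> \<beta>\<close> and \<open>1 \<le> a\<close>, no truncation
    acts on a singleton.\<close>
  have single: "hidden_cost \<kappa> a \<beta> R {j} = 1" for j
    using assms by (cases "j \<in> R") (auto simp: hidden_cost_def insert_Diff_if)
  then show "0 < hidden_cost \<kappa> a \<beta> R {j}" for j
    by simp
  have fin: "finite R"
    using assms(6) finite_subset by blast
  \<comment> \<open>As \<open>2 * a + 1 \<le> n\<close>, at least \<open>a\<close> elements of
    \<open>X\<close> lie outside \<open>R\<close>. The truncation is saturated, and the last element
    of the ground set adds only \<open>1 - \<kappa>\<close>.\<close>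
  have large: "hidden_cost \<kappa> a \<beta> R X = \<kappa> * a + (1 - \<kappa>) * real (card X)"
    if "n - 1 \<le> card X" for X
  proof -
    have "card X - card R \<le> card (X - R)"
      using fin by (rule diff_card_le_card_Diff)
    then have "a \<le> card (X - R)"
      using that assms by linarith
    then show ?thesis
      using assms by (simp add: hidden_cost_def min_def)
  qed
  show "curvature {1..n} (hidden_cost \<kappa> a \<beta> R) = \<kappa>"
  proof (rule curvature_eqI)
    fix j assume j: "j \<in> {1..n}"
    then have "{1..n} - {j} \<union> {j} = {1..n}" and "card ({1..n} - {j}) = n - 1"
      by auto
    then show "marginal (hidden_cost \<kappa> a \<beta> R) j ({1..n} - {j}) / hidden_cost \<kappa> a \<beta> R {j} = 1 - \<kappa>"
      using assms unfolding marginal_def single by (simp add: large of_nat_diff algebra_simps)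
  qed (use assms in auto)
qed

lemma polymatroid_with_curvature_near_card:
  assumes "0 < \<kappa>" "\<kappa> \<le> 1" "2 \<le> n"
  shows "polymatroid_with_curvature {1..n} \<kappa> (near_card \<kappa> n)"
  unfolding polymatroid_with_curvature_def
proof (intro conjI ballI)
  show "polymatroid {1..n} (near_card \<kappa> n)"
    unfolding near_card_def using assms
    by (intro polymatroid_add polymatroid_scale polymatroid_truncate polymatroid_card) auto
  have single: "near_card \<kappa> n {j} = 1" for j
    using assms by (auto simp: near_card_def)
  then show "0 < near_card \<kappa> n {j}" for j
    by simp
  show "curvature {1..n} (near_card \<kappa> n) = \<kappa>"
  proof (rule curvature_eqI)
    fix j assume j: "j \<in> {1..n}"
    then have "{1..n} - {j} \<union> {j} = {1..n}" and "card ({1..n} - {j}) = n - 1"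
      by auto
    then show "marginal (near_card \<kappa> n) j ({1..n} - {j}) / near_card \<kappa> n {j} = 1 - \<kappa>"
      using assms unfolding marginal_def single
      by (simp add: near_card_def of_nat_diff algebra_simps)
  qed (use assms in auto)
qed

lemma near_card_le_card: "0 \<le> \<kappa> \<Longrightarrow> near_card \<kappa> n X \<le> real (card X)"
  using mult_left_mono[of "min (real (card X)) (real (n - 1))" "real (card X)" \<kappa>]
  by (simp add: near_card_def algebra_simps)

lemma near_card_eq_card: "card X \<le> n - 1 \<Longrightarrow> near_card \<kappa> n X = real (card X)"
  by (simp add: near_card_def min_def algebra_simps)

lemma hidden_cost_hidden_set:
  assumes "0 \<le> \<kappa>" "card R = a"
  shows "hidden_cost \<kappa> a \<beta> R R \<le> \<kappa> * \<beta> + (1 - \<kappa>) * real a"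
  using assms by (auto simp: hidden_cost_def intro!: mult_left_mono)

text \<open>Against the decoy the cost is a convex combination of \<open>min (card X) a\<close> and
  \<open>card X\<close>, so no set is cheap.\<close>

lemma hidden_cost_empty_ge:
  assumes "0 \<le> \<kappa>" "\<kappa> \<le> 1" "0 \<le> \<beta>" "r \<le> real a" "r \<le> real (card X)"
  shows "r \<le> hidden_cost \<kappa> a \<beta> {} X"
proof -
  have "\<kappa> * r + (1 - \<kappa>) * r \<le> hidden_cost \<kappa> a \<beta> {} X"
    unfolding hidden_cost_def using assms by (intro add_mono mult_left_mono) auto
  then show ?thesis
    by (simp add: algebra_simps)
qed

text \<open>Only sets of size exactly \<open>a\<close> matter for telling \<open>R\<close> from \<open>\<emptyset>\<close>: a smaller distinguishing
  set may be enlarged, and a larger one shrunk.\<close>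

lemma hidden_cost_distinguished:
  assumes "finite V" "a \<le> card V" "X \<subseteq> V" "0 \<le> \<beta>"
  obtains Y where "Y \<subseteq> V" "card Y = a"
    "\<And>R. hidden_cost \<kappa> a \<beta> R X \<noteq> hidden_cost \<kappa> a \<beta> {} X \<Longrightarrow> \<beta> < real (card (Y \<inter> R))"
proof -
  have fin: "finite X"
    using assms finite_subset by blast
  have split: "card X = card (X - R) + card (X \<inter> R)" for R
    using card_Int_Diff[OF fin, of R] by simp
  \<comment> \<open>The costs differ only if the inner truncation at \<open>\<beta>\<close> is
    active and the outer one at \<open>a\<close> is not yet reached for \<open>R\<close>; otherwise
    the truncated parts agree, being \<open>min (card X) a\<close> or \<open>a\<close>.\<close>
  have far: "real (card (X - R)) + \<beta> < min (real (card X)) (real a)"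
    and many: "\<beta> < real (card (X \<inter> R))"
    if "hidden_cost \<kappa> a \<beta> R X \<noteq> hidden_cost \<kappa> a \<beta> {} X" for R
  proof -
    have "min (real (card (X - R)) + min (real (card (X \<inter> R))) \<beta>) (real a)
        \<noteq> min (real (card X)) (real a)"
      using that assms(4) by (auto simp: hidden_cost_def)
    then show "real (card (X - R)) + \<beta> < min (real (card X)) (real a)"
      and "\<beta> < real (card (X \<inter> R))"
      using split[of R] by (auto simp: min_def split: if_splits)
  qed
  \<comment> \<open>In both cases \<open>Y\<close> is chosen from \<open>X\<close> alone, before
    \<open>R\<close> is known, so that one may count over \<open>R\<close> afterwards.\<close>
  show thesis
  proof (cases "card X \<le> a")
    case True
    obtain Y where Y: "X \<subseteq> Y" "Y \<subseteq> V" "card Y = a"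
      using exists_subset_between[of X a V] True assms by auto
    have "card (X \<inter> R) \<le> card (Y \<inter> R)" for R
      using Y assms(1) by (intro card_mono) (auto intro: finite_subset)
    with Y many show thesis
      by (intro that[of Y]) (force intro: less_le_trans)+
  next
    case False
    obtain Y where Y: "Y \<subseteq> X" "card Y = a"
      using obtain_subset_with_card_n[of a X] False by auto
    have finY: "finite Y"
      using Y fin finite_subset by blast
    \<comment> \<open>Like \<open>X - R\<close>, the set \<open>Y - R\<close> has fewer than
      \<open>a - \<beta>\<close> elements, so more than \<open>\<beta>\<close> of the
      \<open>a\<close> elements of \<open>Y\<close> lie in \<open>R\<close>.\<close>
    have "\<beta> < real (card (Y \<inter> R))"
      if "hidden_cost \<kappa> a \<beta> R X \<noteq> hidden_cost \<kappa> a \<beta> {} X" for R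
    proof -
      have "card (Y - R) \<le> card (X - R)"
        using Y fin by (intro card_mono) auto
      with far[OF that] card_Int_Diff[OF finY, of R] Y show ?thesis
        by auto
    qed
    with Y assms(3) show thesis
      by (intro that[of Y]) auto
  qed
qed

section \<open>Random sets of given size\<close>

lemma card_supersets_of_size:
  assumes "finite V" "K \<subseteq> V" "card K \<le> a"
  shows "card {R. R \<subseteq> V \<and> card R = a \<and> K \<subseteq> R} = (card V - card K) choose (a - card K)"
proof -
  have finK: "finite K"
    using assms finite_subset by blast
  have "bij_betw (\<lambda>R. R - K) {R. R \<subseteq> V \<and> card R = a \<and> K \<subseteq> R}
      {S. S \<subseteq> V - K \<and> card S = a - card K}"
  proof (rule bij_betwI[where g = "\<lambda>S. S \<union> K"])
    show "(\<lambda>R. R - K) \<in> {R. R \<subseteq> V \<and> card R = a \<and> K \<subseteq> R} \<rightarrow> {S. S \<subseteq> V - K \<and> card S = a - card K}"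
      using finK by (auto simp: card_Diff_subset)
    show "(\<lambda>S. S \<union> K) \<in> {S. S \<subseteq> V - K \<and> card S = a - card K} \<rightarrow> {R. R \<subseteq> V \<and> card R = a \<and> K \<subseteq> R}"
    proof
      fix S assume S: "S \<in> {S. S \<subseteq> V - K \<and> card S = a - card K}"
      then have "finite S"
        using assms(1) by (auto intro: finite_subset)
      then have "card (S \<union> K) = card S + card K"
        using S finK by (intro card_Un_disjoint) auto
      then show "S \<union> K \<in> {R. R \<subseteq> V \<and> card R = a \<and> K \<subseteq> R}"
        using S assms by auto
    qed
  qed auto
  then have "card {R. R \<subseteq> V \<and> card R = a \<and> K \<subseteq> R} = card {S. S \<subseteq> V - K \<and> card S = a - card K}"
    by (rule bij_betw_same_card)
  then show ?thesis
    using assms finK by (simp add: n_subsets card_Diff_subset)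
qed

text \<open>The share of \<open>a\<close>-subsets that contain a fixed \<open>k\<close>-set is the
  product of \<open>(a - i) / (n - i)\<close> over \<open>i < k\<close>, and each factor is at most
  \<open>a / n\<close>.\<close>

lemma power_mult_binomial_diff_le:
  fixes n a k :: nat
  assumes "k \<le> a" "a \<le> n"
  shows "n ^ k * ((n - k) choose (a - k)) \<le> a ^ k * (n choose a)"
  using assms(1)
proof (induction k)
  case (Suc k)
  obtain a' where a': "a - k = Suc a'"
    using Suc.prems by (metis Suc_diff_le diff_Suc_Suc)
  obtain n' where n': "n - k = Suc n'"
    using Suc.prems assms(2) by (metis Suc_diff_le diff_Suc_Suc le_trans)
  \<comment> \<open>Absorption identity: it supplies the factor
    \<open>(a - k) / (n - k)\<close>.\<close>
  have absorb: "(n - k) * ((n - Suc k) choose (a - Suc k)) = (a - k) * ((n - k) choose (a - k))"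
    using Suc_times_binomial_eq[of n' a'] a' n' by (simp add: diff_Suc mult.commute)
  have "(a - k) * n \<le> a * (n - k)"
    using assms(2) by (simp add: diff_mult_distrib diff_mult_distrib2 diff_le_mono2 mult.commute)
  then have "(n - k) * (n * ((n - Suc k) choose (a - Suc k)))
      \<le> (n - k) * (a * ((n - k) choose (a - k)))"
    using mult_right_mono[of "(a - k) * n" "a * (n - k)" "(n - k) choose (a - k)"] absorb
    by (simp add: mult.left_commute[of "n - k"]) (simp add: mult_ac)
  then have "n * ((n - Suc k) choose (a - Suc k)) \<le> a * ((n - k) choose (a - k))"
    using n' by (simp only: mult_le_cancel1)
  then have "n ^ Suc k * ((n - Suc k) choose (a - Suc k)) \<le> n ^ k * (a * ((n - k) choose (a - k)))"
    by (simp add: mult.assoc mult.left_commute)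
  also have "\<dots> \<le> a ^ Suc k * (n choose a)"
    using Suc by (simp add: mult.assoc mult.left_commute)
  finally show ?case .
qed simp

text \<open>Union bound over the \<open>k\<close>-subsets of \<open>Y\<close>: there are at most
  \<open>a ^ k / fact k\<close> of them, and each lies in a share of at most
  \<open>(a / n) ^ k\<close> of the sets \<open>R\<close>.\<close>

lemma card_large_intersection_le:
  assumes "finite V" "Y \<subseteq> V" "card Y = a" "k \<le> a" "V \<noteq> {}"
  shows "real (card {R. R \<subseteq> V \<and> card R = a \<and> k \<le> card (Y \<inter> R)})
    \<le> ((real a)\<^sup>2 / real (card V)) ^ k / fact k * real (card V choose a)"
proof -
  define n where "n = card V"
  have n: "0 < n" "a \<le> n"
    using assms card_mono[of V Y] by (auto simp: n_def card_gt_0_iff)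
  have finY: "finite Y"
    using assms finite_subset by blast
  let ?K = "{K. K \<subseteq> Y \<and> card K = k}"
  let ?S = "\<lambda>K. {R. R \<subseteq> V \<and> card R = a \<and> K \<subseteq> R}"
  have "{R. R \<subseteq> V \<and> card R = a \<and> k \<le> card (Y \<inter> R)} \<subseteq> (\<Union>K\<in>?K. ?S K)"
  proof
    fix R assume R: "R \<in> {R. R \<subseteq> V \<and> card R = a \<and> k \<le> card (Y \<inter> R)}"
    then have "k \<le> card (Y \<inter> R)"
      by simp
    then obtain K where "K \<subseteq> Y \<inter> R" "card K = k"
      by (rule obtain_subset_with_card_n)
    with R show "R \<in> (\<Union>K\<in>?K. ?S K)"
      by auto
  qed
  moreover have "finite (\<Union>K\<in>?K. ?S K)"
    using assms(1) by (auto intro: finite_subset[of _ "Pow V"])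
  ultimately have "card {R. R \<subseteq> V \<and> card R = a \<and> k \<le> card (Y \<inter> R)} \<le> card (\<Union>K\<in>?K. ?S K)"
    by (metis (no_types, lifting) card_mono)
  also have "\<dots> \<le> (\<Sum>K\<in>?K. card (?S K))"
    using finY by (intro card_UN_le) auto
  also have "\<dots> = (\<Sum>K\<in>?K. (n - k) choose (a - k))"
    using assms by (intro sum.cong refl) (auto simp: card_supersets_of_size n_def)
  also have "\<dots> = (a choose k) * ((n - k) choose (a - k))"
    using assms(3) finY by (simp add: n_subsets)
  finally have "real (card {R. R \<subseteq> V \<and> card R = a \<and> k \<le> card (Y \<inter> R)})
      \<le> real (a choose k) * real ((n - k) choose (a - k))"
    by (simp flip: of_nat_mult)
  also have "\<dots> \<le> (real a ^ k / fact k) * ((real a ^ k / real n ^ k) * real (n choose a))"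
  proof (intro mult_mono)
    have "real (fact k * (a choose k)) \<le> real (a ^ k)"
      using binomial_fact_pow[of a k] by (simp add: mult.commute del: of_nat_mult of_nat_power)
    then show "real (a choose k) \<le> real a ^ k / fact k"
      by (simp add: field_simps)
    have "real (n ^ k * ((n - k) choose (a - k))) \<le> real (a ^ k * (n choose a))"
      using power_mult_binomial_diff_le[OF assms(4) n(2)] by (simp del: of_nat_mult of_nat_power)
    then show "real ((n - k) choose (a - k)) \<le> (real a ^ k / real n ^ k) * real (n choose a)"
      using n by (simp add: field_simps)
  qed auto
  also have "\<dots> = ((real a)\<^sup>2 / real n) ^ k / fact k * real (n choose a)"
    by (simp add: power_divide power2_eq_square power_mult_distrib mult_ac)
  finally show ?thesis
    by (simp add: n_def)
qed

text \<open>\<open>k ^ k / fact k\<close> is one term of the series of \<open>exp k\<close>, hence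
  at most \<open>4 ^ k\<close>; the factor 8 turns this into a half power.\<close>

lemma power_over_fact_le_half_power:
  fixes m :: real
  assumes "0 \<le> m" "8 * m \<le> real k"
  shows "m ^ k / fact k \<le> (1/2) ^ k"
proof -
  have "real k ^ k / fact k \<le> exp (real k)"
    using sum_le_suminf[OF summable_exp[of "real k"], of "{k}"]
    by (simp add: exp_def divide_inverse mult.commute)
  also have "\<dots> = exp 1 ^ k"
    by (simp add: exp_of_nat_mult[symmetric])
  also have "\<dots> \<le> 4 ^ k"
    using exp_le by (intro power_mono) auto
  finally have "real k ^ k / fact k \<le> 4 ^ k" .
  moreover have "(8 * m) ^ k / fact k \<le> real k ^ k / fact k"
    using assms by (intro divide_right_mono power_mono) auto
  ultimately have "8 ^ k * (m ^ k / fact k) \<le> 4 ^ k"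
    by (simp add: power_mult_distrib)
  also have "(4 :: real) ^ k = 8 ^ k * (1/2) ^ k"
    by (simp flip: power_mult_distrib)
  finally show ?thesis
    by (simp only: mult_le_cancel_left_pos zero_less_power zero_less_numeral)
qed

text \<open>The mean overlap of a fixed and a random set of size \<open>a\<close> is
  \<open>a\<^sup>2 / card V\<close>. A distinguishing set forces an overlap above
  \<open>\<beta>\<close>, at least eight times this mean.\<close>

lemma card_distinguished_le:
  assumes "finite V" "a \<le> card V" "V \<noteq> {}" "X \<subseteq> V" "0 \<le> \<beta>" "8 * ((real a)\<^sup>2 / real (card V)) \<le> \<beta>"
  shows "real (card {R. R \<subseteq> V \<and> card R = a \<and> hidden_cost \<kappa> a \<beta> R X \<noteq> hidden_cost \<kappa> a \<beta> {} X})
    \<le> 2 powr (-\<beta>) * real (card V choose a)"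
proof -
  obtain Y where Y: "Y \<subseteq> V" "card Y = a"
    and dist: "\<And>R. hidden_cost \<kappa> a \<beta> R X \<noteq> hidden_cost \<kappa> a \<beta> {} X \<Longrightarrow> \<beta> < real (card (Y \<inter> R))"
    using hidden_cost_distinguished[OF assms(1,2,4,5)] by blast
  \<comment> \<open>Rounding up is harmless: an integer above \<open>\<beta>\<close> is at least
    \<open>k\<close>, and \<open>2 powr (- k)\<close> is at most
    \<open>2 powr (-\<beta>)\<close>.\<close>
  define k where "k = nat \<lceil>\<beta>\<rceil>"
  have k: "\<beta> \<le> real k"
    using assms(5) by (simp add: k_def)
  let ?D = "{R. R \<subseteq> V \<and> card R = a \<and> hidden_cost \<kappa> a \<beta> R X \<noteq> hidden_cost \<kappa> a \<beta> {} X}"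
  have sub: "?D \<subseteq> {R. R \<subseteq> V \<and> card R = a \<and> k \<le> card (Y \<inter> R)}"
  proof
    fix R assume R: "R \<in> ?D"
    then have "\<beta> < real (card (Y \<inter> R))"
      using dist by blast
    then have "k \<le> card (Y \<inter> R)"
      unfolding k_def by linarith
    with R show "R \<in> {R. R \<subseteq> V \<and> card R = a \<and> k \<le> card (Y \<inter> R)}"
      by blast
  qed
  show ?thesis
  proof (cases "k \<le> a")
    case True
    have "real (card ?D) \<le> real (card {R. R \<subseteq> V \<and> card R = a \<and> k \<le> card (Y \<inter> R)})"
      using sub assms(1) by (intro of_nat_mono card_mono) (auto intro: finite_subset[of _ "Pow V"])
    also have "\<dots> \<le> ((real a)\<^sup>2 / real (card V)) ^ k / fact k * real (card V choose a)"
      by (rule card_large_intersection_le[OF assms(1) Y True assms(3)])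
    also have "\<dots> \<le> (1/2) ^ k * real (card V choose a)"
      using k assms by (intro mult_right_mono power_over_fact_le_half_power) auto
    also have "(1/2 :: real) ^ k = 2 powr (- real k)"
      by (simp add: powr_minus powr_realpow power_one_over inverse_eq_divide)
    also have "2 powr (- real k) * real (card V choose a) \<le> 2 powr (-\<beta>) * real (card V choose a)"
      using k by (intro mult_right_mono) auto
    finally show ?thesis .
  next
    case False
    have "card (Y \<inter> R) \<le> a" for R
      using Y assms(1) card_mono[of Y "Y \<inter> R"] finite_subset[of Y V] by auto
    then have "{R. R \<subseteq> V \<and> card R = a \<and> k \<le> card (Y \<inter> R)} = {}"
      using False le_trans by blast
    then have "?D = {}"
      using sub by (simp only: subset_empty)
    then show ?thesis
      by (simp only: card.empty) simp
  qed
qed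

section \<open>Oracle computations\<close>

text \<open>Equal answers along the run against \<open>f\<close> make the run against
  \<open>f'\<close> take the same branches.\<close>

lemma returned_cong_queries:
  assumes "\<forall>X\<in>set (queries f g T). f' X = f X"
  shows "returned f' g T = returned f g T"
  using assms by (induction T) auto

text \<open>Exchanging sum and expectation reduces a randomized algorithm to the deterministic
  computations in its support, as in Yao's principle.\<close>

lemma sum_prob_le_of_card_le:
  fixes E :: "'i \<Rightarrow> 'a set"
  assumes "finite S" "\<And>x. x \<in> set_pmf M \<Longrightarrow> real (card {i \<in> S. x \<in> E i}) \<le> B"
  shows "(\<Sum>i\<in>S. measure_pmf.prob M (E i)) \<le> B"
proof -
  have "(\<Sum>i\<in>S. measure_pmf.prob M (E i)) = (\<Sum>i\<in>S. measure_pmf.expectation M (indicator (E i)))"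
    by simp
  also have "\<dots> = measure_pmf.expectation M (\<lambda>x. \<Sum>i\<in>S. indicator (E i) x)"
    by (subst Bochner_Integration.integral_sum) (auto simp: measure_pmf.emeasure_eq_measure)
  also have "\<dots> = measure_pmf.expectation M (\<lambda>x. real (card {i \<in> S. x \<in> E i}))"
    using assms(1) by (intro Bochner_Integration.integral_cong) (auto simp: indicator_def sum.If_cases Int_def)
  also have "\<dots> \<le> B"
    using assms
    by (intro measure_pmf.integral_le_const measure_pmf.integrable_const_bound[where B = "real (card S)"])
      (auto simp: AE_measure_pmf_iff intro!: card_mono)
  finally show ?thesis .
qed

text \<open>Averaging over the hidden set: since the success sets \<open>G R\<close> only contain sets that
  distinguish \<open>R\<close> from \<open>\<emptyset>\<close>, a computation succeeds on \<open>R\<close> only if one of its queries against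
  \<open>\<emptyset>\<close>, or its answer there, distinguishes \<open>R\<close>.\<close>

lemma exists_failing_hidden_set:
  fixes M :: "oracle_comp pmf"
  assumes V: "finite V" "a \<le> card V" "V \<noteq> {}"
    and \<beta>: "0 \<le> \<beta>" "8 * ((real a)\<^sup>2 / real (card V)) \<le> \<beta>"
    and q: "\<And>T. T \<in> set_pmf M \<Longrightarrow> set (queries (hidden_cost \<kappa> a \<beta> {}) g T) \<subseteq> Pow V
        \<and> length (queries (hidden_cost \<kappa> a \<beta> {}) g T) \<le> q"
    and G: "\<And>R X. X \<in> G R \<Longrightarrow> X \<subseteq> V \<and> hidden_cost \<kappa> a \<beta> R X \<noteq> hidden_cost \<kappa> a \<beta> {} X"
    and small: "(real q + 1) * 2 powr (-\<beta>) < \<delta>"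
  shows "\<exists>R. R \<subseteq> V \<and> card R = a \<and>
    measure_pmf.prob (map_pmf (returned (hidden_cost \<kappa> a \<beta> R) g) M) (G R) < \<delta>"
proof (rule ccontr)
  assume contra: "\<not> ?thesis"
  let ?h = "hidden_cost \<kappa> a \<beta>"
  define S where "S = {R. R \<subseteq> V \<and> card R = a}"
  define N where "N = real (card V choose a)"
  have finS: "finite S" and cardS: "real (card S) = N"
    using V by (auto simp: S_def N_def n_subsets)
  have Npos: "0 < N"
    using V by (simp add: N_def)
  \<comment> \<open>For fixed \<open>T\<close> there are at most \<open>q + 1\<close> candidate
    sets, the queries and the answer, and each distinguishes at most a share
    \<open>2 powr (-\<beta>)\<close> of the hidden sets.\<close>
  have "(\<Sum>R\<in>S. measure_pmf.prob M {T. returned (?h R) g T \<in> G R})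
      \<le> (real q + 1) * (2 powr (-\<beta>) * N)"
  proof (rule sum_prob_le_of_card_le[OF finS])
    fix T assume T: "T \<in> set_pmf M"
    \<comment> \<open>The answer on the decoy may lie outside \<open>V\<close>; it is then no
      success, so only its part in \<open>Pow V\<close> is counted.\<close>
    define Q where "Q = insert (returned (?h {}) g T) (set (queries (?h {}) g T)) \<inter> Pow V"
    have "card Q \<le> card (insert (returned (?h {}) g T) (set (queries (?h {}) g T)))"
      unfolding Q_def by (intro card_mono) auto
    also have "\<dots> \<le> Suc (card (set (queries (?h {}) g T)))"
      by (rule card_insert_le_m1) auto
    also have "\<dots> \<le> Suc (length (queries (?h {}) g T))"
      by (simp add: card_length)
    finally have Q: "card Q \<le> Suc q" "finite Q"
      using q[OF T] by (auto simp: Q_def)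
    have "{R \<in> S. T \<in> {T. returned (?h R) g T \<in> G R}}
        \<subseteq> (\<Union>X\<in>Q. {R. R \<subseteq> V \<and> card R = a \<and> ?h R X \<noteq> ?h {} X})"
    proof
      fix R assume R: "R \<in> {R \<in> S. T \<in> {T. returned (?h R) g T \<in> G R}}"
      then have G': "returned (?h R) g T \<subseteq> V" "?h R (returned (?h R) g T) \<noteq> ?h {} (returned (?h R) g T)"
        using G by auto
      have "\<exists>X\<in>Q. ?h R X \<noteq> ?h {} X"
      proof (cases "\<forall>X\<in>set (queries (?h {}) g T). ?h R X = ?h {} X")
        case True
        then show ?thesis
          using G' returned_cong_queries[OF True] by (auto simp: Q_def)
      next
        case False
        then show ?thesis
          using q[OF T] by (auto simp: Q_def)
      qed
      with R show "R \<in> (\<Union>X\<in>Q. {R. R \<subseteq> V \<and> card R = a \<and> ?h R X \<noteq> ?h {} X})"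
        by (auto simp: S_def)
    qed
    moreover have "finite (\<Union>X\<in>Q. {R. R \<subseteq> V \<and> card R = a \<and> ?h R X \<noteq> ?h {} X})"
      using V(1) by (auto intro: finite_subset[of _ "Pow V"])
    ultimately have "card {R \<in> S. T \<in> {T. returned (?h R) g T \<in> G R}}
        \<le> card (\<Union>X\<in>Q. {R. R \<subseteq> V \<and> card R = a \<and> ?h R X \<noteq> ?h {} X})"
      by (metis (no_types, lifting) card_mono)
    also have "\<dots> \<le> (\<Sum>X\<in>Q. card {R. R \<subseteq> V \<and> card R = a \<and> ?h R X \<noteq> ?h {} X})"
      using Q by (intro card_UN_le) auto
    finally have "real (card {R \<in> S. T \<in> {T. returned (?h R) g T \<in> G R}})
        \<le> (\<Sum>X\<in>Q. real (card {R. R \<subseteq> V \<and> card R = a \<and> ?h R X \<noteq> ?h {} X}))"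
      by (simp flip: of_nat_sum)
    also have "\<dots> \<le> (\<Sum>X\<in>Q. 2 powr (-\<beta>) * N)"
      unfolding N_def using V \<beta> by (intro sum_mono card_distinguished_le) (auto simp: Q_def)
    also have "\<dots> \<le> (real q + 1) * (2 powr (-\<beta>) * N)"
      using Q Npos by (simp add: mult_right_mono)
    finally show "real (card {R \<in> S. T \<in> {T. returned (?h R) g T \<in> G R}})
        \<le> (real q + 1) * (2 powr (-\<beta>) * N)" .
  qed
  \<comment> \<open>If no hidden set failed, each of the \<open>N\<close> would contribute at least
    \<open>\<delta>\<close>.\<close>
  moreover have "N * \<delta> \<le> (\<Sum>R\<in>S. measure_pmf.prob M {T. returned (?h R) g T \<in> G R})"
  proof -
    have "(\<Sum>R\<in>S. \<delta>) \<le> (\<Sum>R\<in>S. measure_pmf.prob M {T. returned (?h R) g T \<in> G R})"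
      using contra by (intro sum_mono) (force simp: S_def vimage_def not_less)
    then show ?thesis
      by (simp add: cardS)
  qed
  moreover have "(real q + 1) * (2 powr (-\<beta>) * N) < N * \<delta>"
    using mult_strict_left_mono[OF small Npos] by (simp add: mult_ac)
  ultimately show False
    by linarith
qed

section \<open>Choice of parameters\<close>

lemma poly_mult_tendsto_0:
  fixes p :: "nat poly" and u :: "nat \<Rightarrow> real"
  assumes "\<And>d. (\<lambda>n. real n ^ d * u n) \<longlonglongrightarrow> 0"
  shows "(\<lambda>n. real (poly p n) * u n) \<longlonglongrightarrow> 0"
proof -
  \<comment> \<open>The free power \<open>d\<close> strengthens the induction: multiplying
    \<open>p\<close> by the variable raises \<open>d\<close> by one.\<close>
  have "(\<lambda>n. real n ^ d * (real (poly p n) * u n)) \<longlonglongrightarrow> 0" for d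
  proof (induction p arbitrary: d)
    case (pCons c p)
    have "(\<lambda>n. real c * (real n ^ d * u n) + real n ^ Suc d * (real (poly p n) * u n))
        \<longlonglongrightarrow> real c * 0 + 0"
      by (intro tendsto_intros assms pCons.IH)
    then show ?case
      by (simp add: algebra_simps)
  qed simp
  from this[of 0] show ?thesis
    by simp
qed

text \<open>With \<open>x = n powr (1/2 - \<epsilon>)\<close> the factor is
  \<open>x / (\<kappa> + (1 - \<kappa>) * x)\<close>. By \<open>\<beta> * x \<le> a\<close> it is at
  most \<open>a\<close> over the cost bound \<open>\<kappa> * \<beta> + (1 - \<kappa>) * a\<close>
  of the hidden set.\<close>

lemma below_hardness_factor:
  assumes "0 < \<kappa>" "\<kappa> \<le> 1" "0 < n" "0 \<le> \<sigma>" "0 < \<rho>" "0 < a"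
    and less: "\<sigma> / \<rho> < hardness_factor \<kappa> \<epsilon> n"
    and le: "\<beta> * real n powr (1/2 - \<epsilon>) \<le> a"
  shows "\<sigma> * (\<kappa> * \<beta> + (1 - \<kappa>) * a) < \<rho> * a"
proof -
  define x where "x = real n powr (1/2 - \<epsilon>)"
  have x: "0 < x" "\<beta> * x \<le> a"
    using assms by (auto simp: x_def)
  have den: "0 < \<kappa> + (1 - \<kappa>) * x"
    using assms x by (intro add_pos_nonneg) auto
  have "\<sigma> / \<rho> < x / (\<kappa> + (1 - \<kappa>) * x)"
    using less by (simp add: hardness_factor_def x_def algebra_simps)
  then have "\<sigma> * (\<kappa> + (1 - \<kappa>) * x) < \<rho> * x"
    using den \<open>0 < \<rho>\<close> by (simp add: divide_simps mult_ac)
  then have "a * (\<sigma> * (\<kappa> + (1 - \<kappa>) * x)) < a * (\<rho> * x)"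
    using \<open>0 < a\<close> by (rule mult_strict_left_mono)
  moreover have "\<sigma> * \<kappa> * (\<beta> * x) \<le> \<sigma> * \<kappa> * a"
    using assms x by (intro mult_left_mono) auto
  ultimately have "x * (\<sigma> * (\<kappa> * \<beta> + (1 - \<kappa>) * a)) < x * (\<rho> * a)"
    by (simp add: algebra_simps)
  then show ?thesis
    using x by simp
qed

definition hidden_size :: "real \<Rightarrow> nat \<Rightarrow> nat" where
  "hidden_size e n = nat \<lfloor>real n powr (1/2 + e)\<rfloor>"

text \<open>\<open>n powr (2 * e)\<close> bounds the mean overlap \<open>a\<^sup>2 / n\<close>; the
  8 is the one of the tail bound.\<close>

definition overlap_bound :: "real \<Rightarrow> nat \<Rightarrow> real" where
  "overlap_bound e n = 8 * real n powr (2 * e)"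

text \<open>The size conditions for curvature \<open>\<kappa>\<close>. Where they fail the hard
  family is empty, so its curvature claim holds at every \<open>n\<close>.\<close>

definition admissible :: "real \<Rightarrow> nat \<Rightarrow> bool" where
  "admissible e n \<longleftrightarrow>
     1 \<le> hidden_size e n \<and> 2 * hidden_size e n + 1 \<le> n \<and> 1 \<le> overlap_bound e n"

lemma hidden_size_bounds:
  fixes e :: real and n :: nat
  shows
  "real (hidden_size e n) \<le> real n powr (1/2 + e)"
  "real n powr (1/2 + e) - 1 \<le> real (hidden_size e n)"
proof -
  have "0 \<le> real n powr (1/2 + e)"
    by simp
  then show "real (hidden_size e n) \<le> real n powr (1/2 + e)"
    "real n powr (1/2 + e) - 1 \<le> real (hidden_size e n)"
    unfolding hidden_size_def by linarith+
qed

lemma eventually_admissible: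
  assumes "0 < e" "e < 1/2"
  shows "\<forall>\<^sub>F n in sequentially. admissible e n"
proof -
  have "\<forall>\<^sub>F n :: nat in sequentially. 2 \<le> real n powr (1/2 + e)"
    "\<forall>\<^sub>F n :: nat in sequentially. 2 * real n powr (1/2 + e) + 1 \<le> real n"
    "\<forall>\<^sub>F n :: nat in sequentially. 1 \<le> 8 * real n powr (2 * e)"
    using assms by real_asymp+
  then show ?thesis
  proof eventually_elim
    case (elim n)
    then show ?case
      using hidden_size_bounds[where n = n and e = e] by (simp add: admissible_def overlap_bound_def)
  qed
qed

lemma overlap_bound_ge:
  assumes "0 < n"
  shows "8 * ((real (hidden_size e n))\<^sup>2 / real n) \<le> overlap_bound e n"
proof -
  have "(real (hidden_size e n))\<^sup>2 \<le> (real n powr (1/2 + e))\<^sup>2"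
    using hidden_size_bounds by (intro power_mono) auto
  also have "\<dots> = real n * real n powr (2 * e)"
    using assms by (simp add: powr_power powr_add algebra_simps)
  finally show ?thesis
    using assms by (simp add: overlap_bound_def field_simps)
qed

text \<open>The exponent \<open>2 * e + 1/2 - \<epsilon>\<close> is below \<open>1/2 + e\<close>,
  which absorbs the constant 8 and the rounding.\<close>

lemma eventually_gap:
  assumes "0 < e" "e < \<epsilon>"
  shows "\<forall>\<^sub>F n in sequentially.
    overlap_bound e n * real n powr (1/2 - \<epsilon>) \<le> real (hidden_size e n)"
proof -
  have "\<forall>\<^sub>F n :: nat in sequentially.
      8 * real n powr (2 * e) * real n powr (1/2 - \<epsilon>) \<le> real n powr (1/2 + e) - 1"
    using assms by real_asymp
  then show ?thesis
  proof eventually_elim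
    case (elim n)
    then show ?case
      using hidden_size_bounds(2)[of n e] by (simp add: overlap_bound_def)
  qed
qed

text \<open>The exponent \<open>8 * n powr (2 * e)\<close> outgrows every multiple of
  \<open>ln n\<close>; using \<open>p + 1\<close> accounts for the final answer.\<close>

lemma eventually_few_queries:
  fixes p :: "nat poly"
  assumes "0 < e" "0 < \<delta>"
  shows "\<forall>\<^sub>F n in sequentially. (real (poly p n) + 1) * 2 powr (- overlap_bound e n) < \<delta>"
proof -
  have "(\<lambda>n. real n ^ d * 2 powr (- overlap_bound e n)) \<longlonglongrightarrow> 0" for d
    unfolding overlap_bound_def using assms by real_asymp
  then have "(\<lambda>n. real (poly (p + 1) n) * 2 powr (- overlap_bound e n)) \<longlonglongrightarrow> 0"
    by (rule poly_mult_tendsto_0)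
  then show ?thesis
    using assms(2) by (auto dest!: order_tendstoD(2) simp: add.commute)
qed

section \<open>The hard family, and the hardness of both problems on it\<close>

text \<open>The decoy \<open>R = \<emptyset>\<close> belongs to the family because the query bound of an algorithm is only
  promised on the family, and the averaging argument needs it on the decoy.\<close>

definition hard_family :: "real \<Rightarrow> real \<Rightarrow> family" where
  "hard_family \<kappa> e n =
     {(hidden_cost \<kappa> (hidden_size e n) (overlap_bound e n) R, near_card \<kappa> n) | R.
        admissible e n \<and> R \<subseteq> {1..n} \<and> (card R = hidden_size e n \<or> R = {})}"

lemma hard_family_curvature:
  assumes "0 < \<kappa>" "\<kappa> \<le> 1" "(f, g) \<in> hard_family \<kappa> e n"
  shows "polymatroid_with_curvature {1..n} \<kappa> f \<and> polymatroid_with_curvature {1..n} \<kappa> g"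
proof -
  obtain R where "f = hidden_cost \<kappa> (hidden_size e n) (overlap_bound e n) R" "g = near_card \<kappa> n"
    "admissible e n" "R \<subseteq> {1..n}" "card R \<le> hidden_size e n"
    using assms(3) by (auto simp: hard_family_def)
  then show ?thesis
    using assms unfolding admissible_def
    by (simp only: polymatroid_with_curvature_hidden_cost)
      (auto intro: polymatroid_with_curvature_near_card[simplified])
qed

text \<open>The achievement predicates constrain an algorithm only when an optimum exists;
  finiteness provides one as soon as some set is feasible.\<close>

lemma exists_SCSC_optimal:
  assumes "finite V" "X \<subseteq> V" "c \<le> g X"
  obtains X' where "SCSC_optimal V f g c X'" "f X' \<le> f X"
proof -
  let ?S = "{Y. Y \<subseteq> V \<and> c \<le> g Y}"
  have "finite ?S" "?S \<noteq> {}"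
    using assms by auto
  then obtain X' where X': "X' \<in> ?S" "\<forall>Y\<in>?S. f X' \<le> f Y"
    by (meson arg_min_if_finite(1) arg_min_least)
  show thesis
  proof
    show "SCSC_optimal V f g c X'"
      using X' by (auto simp: SCSC_optimal_def is_arg_min_def not_less)
    show "f X' \<le> f X"
      using X' assms by auto
  qed
qed

lemma exists_SCSK_optimal:
  assumes "finite V" "X \<subseteq> V" "f X \<le> b"
  obtains X' where "SCSK_optimal V f g b X'" "g X \<le> g X'"
proof -
  let ?S = "{Y. Y \<subseteq> V \<and> f Y \<le> b}"
  have "finite ?S" "?S \<noteq> {}"
    using assms by auto
  then obtain X' where X': "X' \<in> ?S" "\<forall>Y\<in>?S. - g X' \<le> - g Y"
    by (meson arg_min_if_finite(1) arg_min_least[where f = "\<lambda>Y. - g Y"])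
  show thesis
  proof
    show "SCSK_optimal V f g b X'"
      using X' by (auto simp: SCSK_optimal_def is_arg_max_def not_less)
    show "g X \<le> g X'"
      using X' assms by auto
  qed
qed

theorem theorem7:
  fixes \<kappa> \<epsilon> :: real
  assumes "0 < \<kappa>" and "\<kappa> \<le> 1" and "0 < \<epsilon>"
  shows "\<exists>F :: family.
    (\<forall>n. \<forall>(f, g) \<in> F n. polymatroid_with_curvature {1..n} \<kappa> f \<and>
                       polymatroid_with_curvature {1..n} \<kappa> g) \<and>
    (\<forall>(A :: algorithm) (\<delta> :: real). polynomially_many_queries F A \<and> 0 < \<delta> \<longrightarrow>
       (\<forall>\<^sub>F n in sequentially. \<forall>\<sigma> \<rho> :: real.
          1 \<le> \<sigma> \<and> 0 < \<rho> \<and> \<rho> \<le> 1 \<and> \<sigma> / \<rho> < hardness_factor \<kappa> \<epsilon> n \<longrightarrow>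
          \<not> SCSC_achieves F \<delta> A n \<sigma> \<rho> \<and> \<not> SCSK_achieves F \<delta> A n \<rho> \<sigma>))"
proof -
  \<comment> \<open>\<open>e < \<epsilon>\<close> gives the gap, and \<open>e < 1/2\<close> makes
    the hidden set a vanishing fraction of the ground set.\<close>
  define e where "e = min \<epsilon> (1/2) / 2"
  have e: "0 < e" "e < \<epsilon>" "e < 1/2"
    using assms by (auto simp: e_def min_def)
  define F where "F = hard_family \<kappa> e"
  have "\<forall>\<^sub>F n in sequentially. \<forall>\<sigma> \<rho> :: real.
      1 \<le> \<sigma> \<and> 0 < \<rho> \<and> \<rho> \<le> 1 \<and> \<sigma> / \<rho> < hardness_factor \<kappa> \<epsilon> n \<longrightarrow>
      \<not> SCSC_achieves F \<delta> A n \<sigma> \<rho> \<and> \<not> SCSK_achieves F \<delta> A n \<rho> \<sigma>"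
    if poly: "polynomially_many_queries F A" and \<delta>: "0 < \<delta>" for A :: algorithm and \<delta> :: real
  proof -
    obtain p :: "nat poly" where p: "\<And>n f g t T. (f, g) \<in> F n \<Longrightarrow> T \<in> set_pmf (A n t) \<Longrightarrow>
        set (queries f g T) \<subseteq> Pow {1..n} \<and> length (queries f g T) \<le> poly p n"
      using poly unfolding polynomially_many_queries_def by (force split: prod.splits)
    show ?thesis
      using eventually_admissible[OF e(1,3)] eventually_gap[OF e(1,2)]
        eventually_few_queries[OF e(1) \<delta>, of p]
    proof eventually_elim
      case (elim n)
      define a where "a = hidden_size e n"
      define \<beta> where "\<beta> = overlap_bound e n"
      \<comment> \<open>An upper bound on the cost of the hidden set: the budget for SCSK, and a
        bound on the optimum for SCSC with threshold \<open>a\<close>.\<close>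
      define b where "b = \<kappa> * \<beta> + (1 - \<kappa>) * real a"
      define g where "g = near_card \<kappa> n"
      have n: "1 \<le> a" "2 * a + 1 \<le> n" "1 \<le> \<beta>"
        using elim(1) by (auto simp: admissible_def a_def \<beta>_def)
      have inF: "(hidden_cost \<kappa> a \<beta> R, g) \<in> F n" if "R \<subseteq> {1..n}" "card R = a \<or> R = {}" for R
        using that elim(1) by (auto simp: F_def hard_family_def a_def \<beta>_def g_def)
      show ?case
      proof (intro allI impI)
        fix \<sigma> \<rho> :: real
        assume *: "1 \<le> \<sigma> \<and> 0 < \<rho> \<and> \<rho> \<le> 1 \<and> \<sigma> / \<rho> < hardness_factor \<kappa> \<epsilon> n"
        have gap: "\<sigma> * b < \<rho> * real a"
          unfolding b_def using * assms n elim(2)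
          by (intro below_hardness_factor[of \<kappa> n \<sigma> \<rho> "real a" \<epsilon>]) (auto simp: a_def \<beta>_def)
        \<comment> \<open>One success set serves both problems.\<close>
        define G where
          "G R = {X. X \<subseteq> {1..n} \<and> hidden_cost \<kappa> a \<beta> R X \<le> \<sigma> * b \<and> \<rho> * real a \<le> g X}" for R
        have G: "X \<subseteq> {1..n} \<and> hidden_cost \<kappa> a \<beta> R X \<noteq> hidden_cost \<kappa> a \<beta> {} X"
          if "X \<in> G R" for R X
        proof -
          have X: "X \<subseteq> {1..n}" "hidden_cost \<kappa> a \<beta> R X \<le> \<sigma> * b" "\<rho> * real a \<le> g X"
            using that by (auto simp: G_def)
          \<comment> \<open>As \<open>g X \<le> card X\<close>, a success has at least
            \<open>\<rho> * a\<close> elements. On the decoy it therefore costs more than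
            \<open>\<sigma> * b\<close>, and so it distinguishes \<open>R\<close>.\<close>
          have "\<rho> * real a \<le> hidden_cost \<kappa> a \<beta> {} X"
            using assms n * X(3) near_card_le_card[of \<kappa> n X]
            by (intro hidden_cost_empty_ge) (auto simp: g_def mult_left_le_one_le)
          with X gap show ?thesis
            by auto
        qed
        \<comment> \<open>The failing set may depend on the threshold \<open>t\<close> given to the
          algorithm; \<open>t = a\<close> and \<open>t = b\<close> are used below.\<close>
        have "\<exists>R. R \<subseteq> {1..n} \<and> card R = a \<and>
            measure_pmf.prob (map_pmf (returned (hidden_cost \<kappa> a \<beta> R) g) (A n t)) (G R) < \<delta>" for t
          using n G p[OF inF] overlap_bound_ge[of n e] elim(3)
          by (intro exists_failing_hidden_set[where q = "poly p n"]) (auto simp: a_def \<beta>_def)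
        then obtain R where R: "\<And>t. R t \<subseteq> {1..n}" "\<And>t. card (R t) = a"
          "\<And>t. measure_pmf.prob (map_pmf (returned (hidden_cost \<kappa> a \<beta> (R t)) g) (A n t)) (G (R t)) < \<delta>"
          by metis
        have gR: "g (R t) = real a" for t
          using R n by (simp add: g_def near_card_eq_card)
        have fR: "hidden_cost \<kappa> a \<beta> (R t) (R t) \<le> b" for t
          unfolding b_def using assms R by (intro hidden_cost_hidden_set) auto
        have "\<not> SCSC_achieves F \<delta> A n \<sigma> \<rho>"
        proof
          assume ach: "SCSC_achieves F \<delta> A n \<sigma> \<rho>"
          let ?f = "hidden_cost \<kappa> a \<beta> (R (real a))"
          obtain X\<^sub>o where X\<^sub>o: "SCSC_optimal {1..n} ?f g (real a) X\<^sub>o" "?f X\<^sub>o \<le> ?f (R (real a))"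
            using exists_SCSC_optimal[of "{1..n}" "R (real a)" "real a" g ?f] R gR by auto
          have "\<delta> \<le> measure_pmf.prob (map_pmf (returned ?f g) (A n (real a)))
              {X. X \<subseteq> {1..n} \<and> ?f X \<le> \<sigma> * ?f X\<^sub>o \<and> g X \<ge> \<rho> * real a}"
            using ach X\<^sub>o(1) inF[of "R (real a)"] R unfolding SCSC_achieves_def by blast
          also have "\<dots> \<le> measure_pmf.prob (map_pmf (returned ?f g) (A n (real a))) (G (R (real a)))"
          proof (intro measure_pmf.finite_measure_mono)
            have "\<sigma> * ?f X\<^sub>o \<le> \<sigma> * b"
              using * X\<^sub>o(2) fR[of "real a"] by (intro mult_left_mono) auto
            then show "{X. X \<subseteq> {1..n} \<and> ?f X \<le> \<sigma> * ?f X\<^sub>o \<and> g X \<ge> \<rho> * real a} \<subseteq> G (R (real a))"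
              by (auto simp: G_def)
          qed auto
          finally show False
            using R(3)[of "real a"] by linarith
        qed
        moreover have "\<not> SCSK_achieves F \<delta> A n \<rho> \<sigma>"
        proof
          assume ach: "SCSK_achieves F \<delta> A n \<rho> \<sigma>"
          let ?f = "hidden_cost \<kappa> a \<beta> (R b)"
          obtain X\<^sub>o where X\<^sub>o: "SCSK_optimal {1..n} ?f g b X\<^sub>o" "g (R b) \<le> g X\<^sub>o"
            using exists_SCSK_optimal[of "{1..n}" "R b" ?f b g] R fR by auto
          have "\<delta> \<le> measure_pmf.prob (map_pmf (returned ?f g) (A n b))
              {X. X \<subseteq> {1..n} \<and> g X \<ge> \<rho> * g X\<^sub>o \<and> ?f X \<le> \<sigma> * b}"
            using ach X\<^sub>o(1) inF[of "R b"] R unfolding SCSK_achieves_def by blast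
          also have "\<dots> \<le> measure_pmf.prob (map_pmf (returned ?f g) (A n b)) (G (R b))"
          proof (intro measure_pmf.finite_measure_mono)
            have "\<rho> * real a \<le> \<rho> * g X\<^sub>o"
              using * X\<^sub>o(2) gR[of b] by (intro mult_left_mono) auto
            then show "{X. X \<subseteq> {1..n} \<and> g X \<ge> \<rho> * g X\<^sub>o \<and> ?f X \<le> \<sigma> * b} \<subseteq> G (R b)"
              by (auto simp: G_def)
          qed auto
          finally show False
            using R(3)[of b] by linarith
        qed
        ultimately show "\<not> SCSC_achieves F \<delta> A n \<sigma> \<rho> \<and> \<not> SCSK_achieves F \<delta> A n \<rho> \<sigma>"
          by blast
      qed
    qed
  qed
  moreover have "\<forall>n. \<forall>(f, g) \<in> F n. polymatroid_with_curvature {1..n} \<kappa> f \<and>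
      polymatroid_with_curvature {1..n} \<kappa> g"
    unfolding F_def using hard_family_curvature[OF assms(1,2)] by blast
  ultimately show ?thesis
    by blast
qed

end
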